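(* Let $M=\mathbb{R}_{>0}\times\mathbb{R}^n$ with coordinates $(\sigma,m_1,\dots,m_n)$ and Riemannian metric $$G=\frac{1}{\sigma^2}\left(2n\,d\sigma^2+dm_1^2+\cdots+dm_n^2\right),$$ and let $B=\{\sigma\in\mathbb{R}_{>0}\}$, $F=\{(m_1,\dots,m_n)\mid m_i\in\mathbb{R}\}$. Let $D$ be an affine connection on $M$ such that $D$ and its dual $D^*$ with respect to $G$ are torsion free, and let $\widetilde\nabla^F$ be the affine connection on $F$ defined by the natural projection of $D$. Assume that $D_XY$ is horizontal, i.e. $D_XY\in\mathcal{L}(B)$, for all $X,Y\in\mathcal{L}(B)$, that $\mathrm{Ver}(D_VW)=\mathrm{Lift}(\widetilde\nabla^F_VW)$ for all $V,W\in\mathcal{L}(F)$, and that the curvature $R$ of $D$ and the curvature ${}^FR$ of $\widetilde\nabla^F$ both vanish. Then $$D_{\partial_\sigma}\partial_\sigma=\frac1\sigma\,\partial_\sigma\quad\text{or}\quad D_{\partial_\sigma}\partial_\sigma=-\frac3\sigma\,\partial_\sigma,$$ where $\partial_\sigma=\frac{\partial}{\partial\sigma}$.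
   Context: $(M,G)$ is the Takano Gaussian space: $G$ is the Fisher metric on the family of Gaussian distributions on $\mathbb{R}^n$ with mean $(m_1,\dots,m_n)$ and covariance $\sigma^2 I$. The dual connection $D^*$ of $D$ is defined by $XG(Y,Z)=G(D_XY,Z)+G(Y,D^*_XZ)$ for all vector fields $X,Y,Z$. $\mathcal{L}(B)$ and $\mathcal{L}(F)$ denote the sets of lifts to $M=B\times F$ of vector fields on $B$ and on $F$, respectively. $\mathrm{Ver}$ denotes the projection of $TM$ onto $TF$. For $V,W\in\mathcal{L}(F)$, $\mathrm{Lift}(\widetilde\nabla^F_VW)$ is the lift to $M$ of the vector field on $F$ obtained by applying $\widetilde\nabla^F$ to the vector fields on $F$ of which $V,W$ are the lifts. That $\widetilde\nabla^F$ is defined by the natural projection of $D$ means that for vector fields on $F$ with lifts $V,W$, it is the projection to $F$ of $D_VW$; the second condition says that this is well defined and that $\mathrm{Ver}(D_VW)$ is its lift.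
   Formalization: The formal theorem assumes n ≥ 2; for n = 1 the claim is false, e.g. with w = √(1+σ²): D_σ∂_σ = ((w−1+1/w)/σ)∂_σ, D_σ∂_m = D_m∂_σ = ((w−1)/σ)∂_m, D_m∂_m = ((w+1)/(2σ))∂_σ. *)

theory Defs
  imports "HOL-Analysis.Analysis"
begin

section \<open>Differential geometry on an open subset of a Euclidean space\<close>

text \<open>
  All manifolds here are open subsets \<open>U\<close> of a Euclidean space with their global coordinates,
  so every tangent space is the ambient space and a vector field on \<open>U\<close> is a smooth map from
  \<open>U\<close> to that space. Fields are total functions; their values outside \<open>U\<close> carry no meaning, and
  all identities are stated at the points of \<open>U\<close>.
\<close>

primrec Ck_on :: "nat \<Rightarrow> 'a::real_normed_vector set \<Rightarrow> ('a \<Rightarrow> 'b::real_normed_vector) \<Rightarrow> bool" where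
  "Ck_on 0 U f \<longleftrightarrow> continuous_on U f"
| "Ck_on (Suc k) U f \<longleftrightarrow>
     (\<forall>p\<in>U. f differentiable (at p)) \<and> (\<forall>v. Ck_on k U (\<lambda>p. frechet_derivative f (at p) v))"

definition smooth_on :: "'a::real_normed_vector set \<Rightarrow> ('a \<Rightarrow> 'b::real_normed_vector) \<Rightarrow> bool" where
  "smooth_on U f \<longleftrightarrow> (\<forall>k. Ck_on k U f)"

definition vector_field_on :: "'a::euclidean_space set \<Rightarrow> ('a \<Rightarrow> 'a) \<Rightarrow> bool" where
  "vector_field_on U X \<longleftrightarrow> smooth_on U X"

text \<open>The derivative \<open>X f\<close> of a function along a vector field.\<close>

definition deriv_along :: "('a::euclidean_space \<Rightarrow> 'a) \<Rightarrow> ('a \<Rightarrow> 'b::real_normed_vector) \<Rightarrow> 'a \<Rightarrow> 'b" where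
  "deriv_along X f p = frechet_derivative f (at p) (X p)"

definition lie_bracket :: "('a::euclidean_space \<Rightarrow> 'a) \<Rightarrow> ('a \<Rightarrow> 'a) \<Rightarrow> 'a \<Rightarrow> 'a" where
  "lie_bracket X Y p = deriv_along X Y p - deriv_along Y X p"

text \<open>
  A connection is given as an operator \<open>D X Y\<close> on vector fields. The second clause says that
  \<open>D X Y\<close> on \<open>U\<close> only depends on \<open>X\<close> and \<open>Y\<close> on \<open>U\<close>; it is needed because fields are total
  functions. Real linearity in \<open>Y\<close> is the case of a constant \<open>f\<close> in the Leibniz rule.
\<close>

definition affine_connection ::
    "'a::euclidean_space set \<Rightarrow> (('a \<Rightarrow> 'a) \<Rightarrow> ('a \<Rightarrow> 'a) \<Rightarrow> 'a \<Rightarrow> 'a) \<Rightarrow> bool" where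
  "affine_connection U D \<longleftrightarrow>
     (\<forall>X Y. vector_field_on U X \<longrightarrow> vector_field_on U Y \<longrightarrow> vector_field_on U (D X Y)) \<and>
     (\<forall>X X' Y Y'. vector_field_on U X \<longrightarrow> vector_field_on U X' \<longrightarrow>
        vector_field_on U Y \<longrightarrow> vector_field_on U Y' \<longrightarrow>
        (\<forall>p\<in>U. X p = X' p) \<longrightarrow> (\<forall>p\<in>U. Y p = Y' p) \<longrightarrow> (\<forall>p\<in>U. D X Y p = D X' Y' p)) \<and>
     (\<forall>X X' Y. vector_field_on U X \<longrightarrow> vector_field_on U X' \<longrightarrow> vector_field_on U Y \<longrightarrow>
        (\<forall>p\<in>U. D (\<lambda>q. X q + X' q) Y p = D X Y p + D X' Y p)) \<and>
     (\<forall>(f :: 'a \<Rightarrow> real) X Y. smooth_on U f \<longrightarrow> vector_field_on U X \<longrightarrow> vector_field_on U Y \<longrightarrow>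
        (\<forall>p\<in>U. D (\<lambda>q. f q *\<^sub>R X q) Y p = f p *\<^sub>R D X Y p)) \<and>
     (\<forall>X Y Y'. vector_field_on U X \<longrightarrow> vector_field_on U Y \<longrightarrow> vector_field_on U Y' \<longrightarrow>
        (\<forall>p\<in>U. D X (\<lambda>q. Y q + Y' q) p = D X Y p + D X Y' p)) \<and>
     (\<forall>(f :: 'a \<Rightarrow> real) X Y. smooth_on U f \<longrightarrow> vector_field_on U X \<longrightarrow> vector_field_on U Y \<longrightarrow>
        (\<forall>p\<in>U. D X (\<lambda>q. f q *\<^sub>R Y q) p = deriv_along X f p *\<^sub>R Y p + f p *\<^sub>R D X Y p))"

definition torsion_free ::
    "'a::euclidean_space set \<Rightarrow> (('a \<Rightarrow> 'a) \<Rightarrow> ('a \<Rightarrow> 'a) \<Rightarrow> 'a \<Rightarrow> 'a) \<Rightarrow> bool" where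
  "torsion_free U D \<longleftrightarrow>
     (\<forall>X Y. vector_field_on U X \<longrightarrow> vector_field_on U Y \<longrightarrow>
        (\<forall>p\<in>U. D X Y p - D Y X p - lie_bracket X Y p = 0))"

definition curvature ::
    "(('a::euclidean_space \<Rightarrow> 'a) \<Rightarrow> ('a \<Rightarrow> 'a) \<Rightarrow> 'a \<Rightarrow> 'a) \<Rightarrow>
     ('a \<Rightarrow> 'a) \<Rightarrow> ('a \<Rightarrow> 'a) \<Rightarrow> ('a \<Rightarrow> 'a) \<Rightarrow> 'a \<Rightarrow> 'a" where
  "curvature D X Y Z p = D X (D Y Z) p - D Y (D X Z) p - D (lie_bracket X Y) Z p"

definition curvature_vanishes ::
    "'a::euclidean_space set \<Rightarrow> (('a \<Rightarrow> 'a) \<Rightarrow> ('a \<Rightarrow> 'a) \<Rightarrow> 'a \<Rightarrow> 'a) \<Rightarrow> bool" where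
  "curvature_vanishes U D \<longleftrightarrow>
     (\<forall>X Y Z. vector_field_on U X \<longrightarrow> vector_field_on U Y \<longrightarrow> vector_field_on U Z \<longrightarrow>
        (\<forall>p\<in>U. curvature D X Y Z p = 0))"

text \<open>
  A metric \<open>g\<close> is given by the bilinear forms \<open>g p\<close> on the tangent spaces. For a connection \<open>D\<close>
  and a Riemannian metric the condition below determines \<open>D'\<close> on \<open>U\<close>.
\<close>

definition is_dual_connection ::
    "'a::euclidean_space set \<Rightarrow> ('a \<Rightarrow> 'a \<Rightarrow> 'a \<Rightarrow> real) \<Rightarrow>
     (('a \<Rightarrow> 'a) \<Rightarrow> ('a \<Rightarrow> 'a) \<Rightarrow> 'a \<Rightarrow> 'a) \<Rightarrow> (('a \<Rightarrow> 'a) \<Rightarrow> ('a \<Rightarrow> 'a) \<Rightarrow> 'a \<Rightarrow> 'a) \<Rightarrow> bool" where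
  "is_dual_connection U g D D' \<longleftrightarrow>
     affine_connection U D' \<and>
     (\<forall>X Y Z. vector_field_on U X \<longrightarrow> vector_field_on U Y \<longrightarrow> vector_field_on U Z \<longrightarrow>
        (\<forall>p\<in>U. deriv_along X (\<lambda>q. g q (Y q) (Z q)) p = g p (D X Y p) (Z p) + g p (Y p) (D' X Z p)))"

section \<open>The Takano Gaussian space\<close>

text \<open>
  A point of \<open>M\<close> is \<open>(\<sigma>, m)\<close> with \<open>m = (m\<^sub>1, \<dots>, m\<^sub>n)\<close> and \<open>n = CARD('n)\<close>.
\<close>

definition base_B :: "real set" where
  "base_B = {0<..}"

definition fibre_F :: "(real ^ 'n) set" where
  "fibre_F = UNIV"

definition takano_M :: "(real \<times> (real ^ 'n)) set" where
  "takano_M = base_B \<times> fibre_F"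

definition takano_metric ::
    "real \<times> (real ^ 'n) \<Rightarrow> real \<times> (real ^ 'n) \<Rightarrow> real \<times> (real ^ 'n) \<Rightarrow> real" where
  "takano_metric p v w =
     (1 / (fst p)\<^sup>2) *
     (2 * real CARD('n) * fst v * fst w + (\<Sum>i\<in>UNIV. (snd v $ i) * (snd w $ i)))"

definition d_sigma :: "real \<times> (real ^ 'n) \<Rightarrow> real \<times> (real ^ 'n)" where
  "d_sigma p = (1, 0)"

definition lift_B :: "(real \<Rightarrow> real) \<Rightarrow> real \<times> (real ^ 'n) \<Rightarrow> real \<times> (real ^ 'n)" where
  "lift_B X p = (X (fst p), 0)"

definition lift_F :: "(real ^ 'n \<Rightarrow> real ^ 'n) \<Rightarrow> real \<times> (real ^ 'n) \<Rightarrow> real \<times> (real ^ 'n)" where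
  "lift_F V p = (0, V (snd p))"

definition lifts_B :: "(real \<times> (real ^ 'n) \<Rightarrow> real \<times> (real ^ 'n)) set" where
  "lifts_B = {X. \<exists>X0. vector_field_on base_B X0 \<and> (\<forall>p\<in>takano_M. X p = lift_B X0 p)}"

definition Ver :: "(real \<times> (real ^ 'n) \<Rightarrow> real \<times> (real ^ 'n)) \<Rightarrow> real \<times> (real ^ 'n) \<Rightarrow> real \<times> (real ^ 'n)" where
  "Ver X p = (0, snd (X p))"

text \<open>
  \<open>N\<close> is the connection on \<open>F\<close> defined by the natural projection of \<open>D\<close>: the differential of the
  projection \<open>M \<rightarrow> F\<close>, which is \<open>snd\<close> on each tangent space, takes \<open>D\<close> of the lifts to \<open>N\<close>.
\<close>

definition is_projected_connection ::
    "((real \<times> (real ^ 'n) \<Rightarrow> real \<times> (real ^ 'n)) \<Rightarrow> (real \<times> (real ^ 'n) \<Rightarrow> real \<times> (real ^ 'n)) \<Rightarrow>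
        real \<times> (real ^ 'n) \<Rightarrow> real \<times> (real ^ 'n)) \<Rightarrow>
     ((real ^ 'n \<Rightarrow> real ^ 'n) \<Rightarrow> (real ^ 'n \<Rightarrow> real ^ 'n) \<Rightarrow> real ^ 'n \<Rightarrow> real ^ 'n) \<Rightarrow> bool" where
  "is_projected_connection D N \<longleftrightarrow>
     affine_connection fibre_F N \<and>
     (\<forall>V W. vector_field_on fibre_F V \<longrightarrow> vector_field_on fibre_F W \<longrightarrow>
        (\<forall>p\<in>takano_M. N V W (snd p) = snd (D (lift_F V) (lift_F W) p)))"

text \<open>
  The dimension \<open>n = 1\<close> has to be excluded from the classification of \<open>D\<close> on \<open>\<partial>/\<partial>\<sigma>\<close>. With
  \<open>w = sqrt (1 + \<sigma>\<^sup>2)\<close>, \<open>s = \<partial>/\<partial>\<sigma>\<close> and \<open>e = \<partial>/\<partial>m\<close>, the flat connection given by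
  \<open>D s s = ((w - 1 + 1 / w) / \<sigma>) s\<close>, \<open>D s e = D e s = ((w - 1) / \<sigma>) e\<close>,
  \<open>D e e = ((w + 1) / (2 \<sigma>)) s\<close> is torsion free with torsion-free dual, its projection to \<open>F\<close> is
  the standard flat connection, and \<open>D s s\<close> is neither \<open>(1 / \<sigma>) s\<close> nor \<open>(-3 / \<sigma>) s\<close>.
\<close>

end

theory Submission
  imports Defs
begin

text \<open>
  Write \<open>s = \<partial>/\<partial>\<sigma>\<close>, \<open>e\<^sub>i = \<partial>/\<partial>m\<^sub>i\<close> and \<open>D s s = a s\<close>, where \<open>a\<close> depends on \<open>\<sigma>\<close> only. The curvature
  conditions form an algebraic equation along the fibres and two differential equations transversal to
  them, and together these leave two possible values of \<open>a\<close> at each point.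

  That \<open>D\<close> and its dual are both torsion free makes the cubic form \<open>D G\<close> totally symmetric. Since
  \<open>D s s\<close> is horizontal, it follows that \<open>D s e\<^sub>i = \<Sum>\<^sub>j A\<^sub>i\<^sub>j e\<^sub>j\<close> is vertical
  (\<open>fst_D_sigma_lift\<close>), and that the horizontal part \<open>b\<^sub>i\<^sub>j\<close> of \<open>D e\<^sub>i e\<^sub>j\<close> is given by
  \<open>2 n b\<^sub>i\<^sub>j = A\<^sub>i\<^sub>j + (2/\<sigma>) \<delta>\<^sub>i\<^sub>j\<close> (\<open>fst_D_m_m\<close>).

  The fibres are flat in the projected connection, so the vertical part of \<open>R(e\<^sub>i, e\<^sub>j) e\<^sub>k = 0\<close> is the
  Gauss equation \<open>b\<^sub>j\<^sub>k A\<^sub>i = b\<^sub>i\<^sub>k A\<^sub>j\<close> (\<open>gauss_equation\<close>). Expressed in \<open>A\<close> alone, and for \<open>n \<ge> 2\<close>,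
  it forces \<open>A\<close> to be \<open>0\<close> or \<open>-2/\<sigma>\<close> times the identity at each point.

  Hence \<open>D s e\<^sub>i = x e\<^sub>i\<close> on \<open>M\<close>, and \<open>R(s, e\<^sub>i) s = 0\<close> and \<open>R(s, e\<^sub>i) e\<^sub>i = 0\<close> become
  \<open>x' + x\<^sup>2 = a x\<close> and \<open>x' - 2/\<sigma>\<^sup>2 + (a - x) (x + 2/\<sigma>) = 0\<close>
  (\<open>riccati_equation\<close>, \<open>horizontal_curvature_equation\<close>). Eliminating \<open>x'\<close> gives \<open>\<sigma> a = 1\<close> where
  \<open>x = 0\<close> and \<open>\<sigma> a = -3\<close> where \<open>x = -2/\<sigma>\<close>. As \<open>\<sigma> a\<close> is continuous on the connected base, one of
  the two alternatives holds throughout.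
\<close>

section \<open>Smoothness\<close>

lemma frechet_derivative_bounded_linear_comp:
  assumes "bounded_linear h" "f differentiable (at p)"
  shows "(\<lambda>q. h (f q)) differentiable (at p)"
    and "frechet_derivative (\<lambda>q. h (f q)) (at p) v = h (frechet_derivative f (at p) v)"
proof -
  have "((\<lambda>q. h (f q)) has_derivative (\<lambda>v. h (frechet_derivative f (at p) v))) (at p)"
    using assms bounded_linear.has_derivative frechet_derivative_works by blast
  then show "(\<lambda>q. h (f q)) differentiable (at p)"
    and "frechet_derivative (\<lambda>q. h (f q)) (at p) v = h (frechet_derivative f (at p) v)"
    by (auto simp: differentiable_def frechet_derivative_at[symmetric])
qed

lemma frechet_derivative_comp_bounded_linear:
  assumes "bounded_linear h" "f differentiable (at (h p))"
  shows "(\<lambda>q. f (h q)) differentiable (at p)"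
    and "frechet_derivative (\<lambda>q. f (h q)) (at p) v = frechet_derivative f (at (h p)) (h v)"
proof -
  have "((\<lambda>q. f (h q)) has_derivative (\<lambda>v. frechet_derivative f (at (h p)) (h v))) (at p)"
    using has_derivative_compose[OF bounded_linear_imp_has_derivative[OF assms(1)]]
      assms(2) frechet_derivative_works by blast
  then show "(\<lambda>q. f (h q)) differentiable (at p)"
    and "frechet_derivative (\<lambda>q. f (h q)) (at p) v = frechet_derivative f (at (h p)) (h v)"
    by (auto simp: differentiable_def frechet_derivative_at[symmetric])
qed

lemma frechet_derivative_cong_open:
  assumes "open U" "p \<in> U" "\<And>q. q \<in> U \<Longrightarrow> f q = g q" "f differentiable (at p)"
  shows "g differentiable (at p)" and "frechet_derivative g (at p) = frechet_derivative f (at p)"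
proof -
  have "(g has_derivative frechet_derivative f (at p)) (at p)"
    using assms(4) unfolding frechet_derivative_works
    by (rule has_derivative_transform_within_open) (use assms(1-3) in auto)
  then show "g differentiable (at p)" "frechet_derivative g (at p) = frechet_derivative f (at p)"
    by (auto simp: differentiable_def frechet_derivative_at[symmetric])
qed

lemma Ck_on_cong_open:
  assumes "open U" "\<And>q. q \<in> U \<Longrightarrow> f q = g q" "Ck_on k U f"
  shows "Ck_on k U g"
  using assms(2,3)
proof (induction k arbitrary: f g)
  case 0
  then show ?case using continuous_on_cong by fastforce
next
  case (Suc k)
  have diff: "\<And>p. p \<in> U \<Longrightarrow> f differentiable (at p)"
    using Suc.prems(2) by simp
  have eq: "frechet_derivative g (at p) = frechet_derivative f (at p)" if "p \<in> U" for p
    using frechet_derivative_cong_open(2)[OF assms(1) that Suc.prems(1) diff[OF that]] by simp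
  have "Ck_on k U (\<lambda>p. frechet_derivative g (at p) v)" for v
    by (rule Suc.IH[of "\<lambda>p. frechet_derivative f (at p) v"]) (use eq Suc.prems(2) in auto)
  moreover have "g differentiable (at p)" if "p \<in> U" for p
    using frechet_derivative_cong_open(1)[OF assms(1) that Suc.prems(1) diff[OF that]] by simp
  ultimately show ?case by simp
qed

text \<open>
  On an open set, derivatives of all orders are determined by the values there. This transfers
  smoothness between the different expressions of a field whose values agree only on the manifold.
\<close>

lemma smooth_on_cong_open:
  assumes "open U" "\<And>q. q \<in> U \<Longrightarrow> f q = g q" "smooth_on U f"
  shows "smooth_on U g"
  using assms Ck_on_cong_open unfolding smooth_on_def by blast

lemma smooth_on_bounded_linear_comp:
  assumes "open U" "bounded_linear h" "smooth_on U f"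
  shows "smooth_on U (\<lambda>p. h (f p))"
proof -
  have "Ck_on k U f \<Longrightarrow> Ck_on k U (\<lambda>p. h (f p))" for k
  proof (induction k arbitrary: f)
    case 0
    then show ?case
      using bounded_linear.continuous_on[OF assms(2)] by simp
  next
    case (Suc k)
    \<comment> \<open>the chain rule is available on \<open>U\<close> only, where \<open>f\<close> is differentiable\<close>
    have "Ck_on k U (\<lambda>p. frechet_derivative (\<lambda>q. h (f q)) (at p) v)" for v
      by (rule Ck_on_cong_open[OF assms(1), of "\<lambda>p. h (frechet_derivative f (at p) v)"])
        (use Suc in \<open>auto simp: frechet_derivative_bounded_linear_comp(2)[OF assms(2)]\<close>)
    moreover have "(\<lambda>q. h (f q)) differentiable (at p)" if "p \<in> U" for p
      using Suc.prems that by (intro frechet_derivative_bounded_linear_comp(1)[OF assms(2)]) simp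
    ultimately show ?case by simp
  qed
  then show ?thesis
    using assms(3) unfolding smooth_on_def by blast
qed

lemma smooth_on_comp_bounded_linear:
  assumes "bounded_linear h" "smooth_on UNIV f"
  shows "smooth_on U (\<lambda>p. f (h p))"
proof -
  have "Ck_on k UNIV f \<Longrightarrow> Ck_on k U (\<lambda>p. f (h p))" for k
  proof (induction k arbitrary: f)
    case 0
    then show ?case
      using bounded_linear.continuous_on[OF assms(1) continuous_on_id]
      by (auto intro: continuous_on_compose2)
  next
    case (Suc k)
    have *: "f differentiable (at (h p))" for p using Suc.prems by simp
    have "Ck_on k U (\<lambda>p. frechet_derivative f (at (h p)) (h v))" for v
      using Suc.IH[of "\<lambda>q. frechet_derivative f (at q) (h v)"] Suc.prems by simp
    then show ?case
      by (simp add: frechet_derivative_comp_bounded_linear[OF assms(1) *])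
  qed
  then show ?thesis
    using assms(2) unfolding smooth_on_def by blast
qed

lemma smooth_on_const: "smooth_on U (\<lambda>_. c)"
proof -
  have "Ck_on k U (\<lambda>_. c)" for k
    by (induction k arbitrary: c) auto
  then show ?thesis unfolding smooth_on_def by blast
qed

lemma smooth_on_imp_continuous_on: "smooth_on U f \<Longrightarrow> continuous_on U f"
  unfolding smooth_on_def by (metis Ck_on.simps(1))

lemma smooth_on_imp_differentiable: "smooth_on U f \<Longrightarrow> p \<in> U \<Longrightarrow> f differentiable (at p)"
  unfolding smooth_on_def by (metis Ck_on.simps(2))

section \<open>Affine connections and flatness on constant fields\<close>

lemma deriv_along_const: "deriv_along X (\<lambda>_. c) p = 0"
  by (simp add: deriv_along_def)

lemma lie_bracket_const: "lie_bracket (\<lambda>_. v) (\<lambda>_. w) = (\<lambda>_. 0)"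
  by (auto simp: lie_bracket_def deriv_along_const)

context
  fixes U :: "'a::euclidean_space set" and D
  assumes conn: "affine_connection U D"
begin

lemmas connection_clauses = conn[unfolded affine_connection_def]

lemma connection_field:
  "vector_field_on U X \<Longrightarrow> vector_field_on U Y \<Longrightarrow> vector_field_on U (D X Y)"
  using connection_clauses[THEN conjunct1] by simp

lemma connection_cong_right:
  assumes "vector_field_on U X" "vector_field_on U Y" "vector_field_on U Y'"
    and "\<And>q. q \<in> U \<Longrightarrow> Y q = Y' q" and "p \<in> U"
  shows "D X Y p = D X Y' p"
  by (rule connection_clauses[THEN conjunct2, THEN conjunct1, rule_format,
        OF assms(1,1-3) refl assms(4,5)])

lemma connection_scale_left:
  assumes "smooth_on U f" "vector_field_on U X" "vector_field_on U Y" "p \<in> U"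
  shows "D (\<lambda>q. f q *\<^sub>R X q) Y p = f p *\<^sub>R D X Y p"
  by (rule connection_clauses[THEN conjunct2, THEN conjunct2, THEN conjunct2, THEN conjunct1,
        rule_format, OF assms])

lemma connection_add_right:
  assumes "vector_field_on U X" "vector_field_on U Y" "vector_field_on U Y'" "p \<in> U"
  shows "D X (\<lambda>q. Y q + Y' q) p = D X Y p + D X Y' p"
  by (rule connection_clauses[THEN conjunct2, THEN conjunct2, THEN conjunct2, THEN conjunct2,
        THEN conjunct1, rule_format, OF assms])

lemma connection_leibniz:
  assumes "smooth_on U f" "vector_field_on U X" "vector_field_on U Y" "p \<in> U"
  shows "D X (\<lambda>q. f q *\<^sub>R Y q) p = deriv_along X f p *\<^sub>R Y p + f p *\<^sub>R D X Y p"
  by (rule connection_clauses[THEN conjunct2, THEN conjunct2, THEN conjunct2, THEN conjunct2,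
        THEN conjunct2, rule_format, OF assms])

lemma connection_zero_left:
  assumes "vector_field_on U Y" "p \<in> U"
  shows "D (\<lambda>_. 0) Y p = 0"
proof -
  have "smooth_on U (\<lambda>_::'a. 0::real)" "vector_field_on U (\<lambda>_. 0)"
    by (simp_all add: smooth_on_const vector_field_on_def)
  from connection_scale_left[OF this assms] show ?thesis by simp
qed

text \<open>
  Constant fields commute, so the bracket term of the curvature drops out. All curvature conditions
  are used in this form, since the coordinate fields are constant.
\<close>

lemma flat_const_fields:
  assumes "curvature_vanishes U D" "vector_field_on U Z" "p \<in> U"
  shows "D (\<lambda>_. v) (D (\<lambda>_. w) Z) p = D (\<lambda>_. w) (D (\<lambda>_. v) Z) p"
proof -
  have "vector_field_on U (\<lambda>_::'a. v)" "vector_field_on U (\<lambda>_::'a. w)"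
    by (simp_all add: vector_field_on_def smooth_on_const)
  from assms(1)[unfolded curvature_vanishes_def, rule_format, OF this assms(2,3)]
  have "curvature D (\<lambda>_. v) (\<lambda>_. w) Z p = 0" .
  then show ?thesis
    using assms(2,3) by (simp add: curvature_def lie_bracket_const connection_zero_left)
qed

end

section \<open>Coordinate fields of the Takano Gaussian space\<close>

definition d_m :: "'n \<Rightarrow> real \<times> (real ^ 'n) \<Rightarrow> real \<times> (real ^ 'n)" where
  "d_m i = lift_F (\<lambda>_. axis i 1)"

lemma d_m_const: "d_m i = (\<lambda>_. (0, axis i 1))"
  by (simp add: fun_eq_iff d_m_def lift_F_def)

lemma d_sigma_const: "d_sigma = (\<lambda>_. (1, 0))"
  by (simp add: fun_eq_iff d_sigma_def)

lemma open_takano_M: "open (takano_M :: (real \<times> (real ^ 'n)) set)"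
  by (simp add: takano_M_def base_B_def fibre_F_def open_Times)

lemma in_takano_M_iff: "p \<in> takano_M \<longleftrightarrow> fst p > 0"
  by (cases p) (simp add: takano_M_def base_B_def fibre_F_def)

lemma const_field: "vector_field_on U (\<lambda>_. v)"
  by (simp add: vector_field_on_def smooth_on_const)

lemma field_d_sigma: "vector_field_on U d_sigma"
  and field_d_m: "vector_field_on U (d_m i)"
  by (simp_all add: d_sigma_const d_m_const const_field)

lemma bounded_linear_zero_Pair:
  "bounded_linear (\<lambda>v::'b::real_normed_vector. (0::'a::real_normed_vector, v))"
  by (rule bounded_linear_Pair[OF bounded_linear_zero bounded_linear_ident])

lemma lift_F_field:
  fixes V :: "real ^ 'n \<Rightarrow> real ^ 'n"
  assumes "vector_field_on fibre_F V"
  shows "vector_field_on takano_M (lift_F V)"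
proof -
  have "smooth_on UNIV V"
    using assms by (simp add: vector_field_on_def fibre_F_def)
  then have "smooth_on takano_M (\<lambda>p::real \<times> (real ^ 'n). V (snd p))"
    by (rule smooth_on_comp_bounded_linear[OF bounded_linear_snd])
  from smooth_on_bounded_linear_comp[OF open_takano_M bounded_linear_zero_Pair this]
  show ?thesis
    by (simp add: vector_field_on_def lift_F_def[abs_def])
qed

lemma lie_bracket_d_sigma_lift_F:
  fixes V :: "real ^ 'n \<Rightarrow> real ^ 'n"
  assumes "vector_field_on fibre_F V"
  shows "lie_bracket d_sigma (lift_F V) p = 0"
proof -
  have V: "V differentiable (at (snd p))"
    using smooth_on_imp_differentiable[of UNIV V "snd p"] assms
    by (simp add: vector_field_on_def fibre_F_def)
  note comp = frechet_derivative_comp_bounded_linear[OF bounded_linear_snd V]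
  have "linear (frechet_derivative V (at (snd p)))"
    using V by (rule linear_frechet_derivative)
  then have "frechet_derivative (lift_F V) (at p) (1, 0) = 0"
    using frechet_derivative_bounded_linear_comp(2)[OF bounded_linear_zero_Pair[where 'a = real] comp(1)] comp(2)
    by (simp add: lift_F_def[abs_def] linear_0 zero_prod_def)
  then show ?thesis
    by (simp add: lie_bracket_def deriv_along_const d_sigma_const deriv_along_def)
qed

lemma metric_d_sigma_right:
  fixes v :: "real \<times> (real ^ 'n)"
  shows "takano_metric p v (1, 0) = 2 * real CARD('n) * fst v / (fst p)\<^sup>2"
  by (simp add: takano_metric_def)

lemma metric_d_m_right:
  "takano_metric p v (0, axis i 1) = snd v $ i / (fst p)\<^sup>2"
  by (simp add: takano_metric_def axis_def if_distrib[of "(*) _"] cong: if_cong)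

lemma deriv_along_inverse_fst_squared:
  fixes p :: "real \<times> (real ^ 'n)"
  assumes "p \<in> takano_M"
  shows "deriv_along X (\<lambda>q. c / (fst q)\<^sup>2) p = - 2 * c * fst (X p) / (fst p)^3"
proof -
  have "fst p \<noteq> 0" using assms by (simp add: in_takano_M_iff)
  then have "((\<lambda>q::real \<times> (real ^ 'n). c / (fst q)\<^sup>2) has_derivative
      (\<lambda>v. - 2 * c * fst v / (fst p)^3)) (at p)"
    by (auto intro!: derivative_eq_intros simp: fun_eq_iff field_simps power2_eq_square power3_eq_cube)
  then show ?thesis
    by (simp add: deriv_along_def frechet_derivative_at[symmetric])
qed

section \<open>The structure equations\<close>

text \<open>
  The function \<open>a\<close> is the coefficient in \<open>D s s = a(\<sigma>) s\<close> with \<open>s = \<partial>/\<partial>\<sigma>\<close>, which exists because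
  \<open>D s s\<close> is again a lift from the base. In the comments below \<open>e\<^sub>i = \<partial>/\<partial>m\<^sub>i\<close>, \<open>A\<^sub>i\<^sub>j\<close> is the
  \<open>j\<close>-th component of \<open>D s e\<^sub>i\<close>, and \<open>b\<^sub>i\<^sub>j\<close> is the horizontal component of \<open>D e\<^sub>i e\<^sub>j\<close>.
\<close>

locale flat_takano_connection =
  fixes D Dstar :: "(real \<times> (real ^ 'n) \<Rightarrow> real \<times> (real ^ 'n)) \<Rightarrow>
      (real \<times> (real ^ 'n) \<Rightarrow> real \<times> (real ^ 'n)) \<Rightarrow> real \<times> (real ^ 'n) \<Rightarrow> real \<times> (real ^ 'n)"
    and N :: "(real ^ 'n \<Rightarrow> real ^ 'n) \<Rightarrow> (real ^ 'n \<Rightarrow> real ^ 'n) \<Rightarrow> real ^ 'n \<Rightarrow> real ^ 'n"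
    and a :: "real \<Rightarrow> real"
  assumes conn: "affine_connection takano_M D"
    and dual: "is_dual_connection takano_M takano_metric D Dstar"
    and torsion: "torsion_free takano_M D"
    and torsion': "torsion_free takano_M Dstar"
    and proj: "is_projected_connection D N"
    and flat: "curvature_vanishes takano_M D"
    and flat_F: "curvature_vanishes fibre_F N"
    and D_ss: "\<And>p. p \<in> takano_M \<Longrightarrow> D d_sigma d_sigma p = (a (fst p), 0)"
begin

lemma dualD:
  assumes "vector_field_on takano_M X" "vector_field_on takano_M Y" "vector_field_on takano_M Z"
    and "p \<in> takano_M"
  shows "deriv_along X (\<lambda>q. takano_metric q (Y q) (Z q)) p =
    takano_metric p (D X Y p) (Z p) + takano_metric p (Y p) (Dstar X Z p)"
  by (rule dual[unfolded is_dual_connection_def, THEN conjunct2, rule_format, OF assms])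

lemma projD:
  assumes "vector_field_on fibre_F V" "vector_field_on fibre_F W" "p \<in> takano_M"
  shows "snd (D (lift_F V) (lift_F W) p) = N V W (snd p)"
  by (rule proj[unfolded is_projected_connection_def, THEN conjunct2, rule_format, OF assms,
        symmetric])

lemma N_conn: "affine_connection fibre_F N"
  using proj by (simp add: is_projected_connection_def)

text \<open>
  A lift from the fibre does not depend on \<open>\<sigma>\<close> and so commutes with \<open>s\<close>; hence both torsion-free
  connections may exchange the two fields. The exchange for \<open>Dstar\<close> is what allows the two duality
  identities used below to be combined so that \<open>Dstar\<close> drops out.
\<close>

lemma
  assumes "vector_field_on fibre_F V" "p \<in> takano_M"
  shows D_lift_sigma: "D (lift_F V) d_sigma p = D d_sigma (lift_F V) p"
    and Dstar_lift_sigma: "Dstar (lift_F V) d_sigma p = Dstar d_sigma (lift_F V) p"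
  using torsion torsion' assms(2) lift_F_field[OF assms(1)] field_d_sigma[of takano_M]
    lie_bracket_d_sigma_lift_F[OF assms(1)]
  unfolding torsion_free_def by (metis diff_zero eq_iff_diff_eq_0)+

lemma D_m_sigma:
  assumes "p \<in> takano_M"
  shows "D (d_m i) d_sigma p = D d_sigma (d_m i) p"
    and "Dstar (d_m i) d_sigma p = Dstar d_sigma (d_m i) p"
  unfolding d_m_def
  by (rule D_lift_sigma[OF const_field assms], rule Dstar_lift_sigma[OF const_field assms])

lemma D_m_m_commute:
  assumes "p \<in> takano_M"
  shows "D (d_m i) (d_m j) p = D (d_m j) (d_m i) p"
proof -
  have "lie_bracket (d_m i) (d_m j) p = 0"
    by (simp add: d_m_const lie_bracket_const)
  then show ?thesis
    using torsion assms field_d_m unfolding torsion_free_def by (metis diff_zero eq_iff_diff_eq_0)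
qed

text \<open>
  Duality along a vertical lift \<open>V\<close> for the pair \<open>s, s\<close> says \<open>G(D V s, s) = - G(s, Dstar V s)\<close>,
  since \<open>G(s, s)\<close> depends on \<open>\<sigma>\<close> only. Duality along \<open>s\<close> for the pair \<open>s, V\<close> says
  \<open>G(s, Dstar s V) = - G(D s s, V) = 0\<close>, since \<open>D s s\<close> is horizontal. The exchange rule for
  \<open>Dstar\<close> identifies the two.
\<close>

lemma fst_D_sigma_lift:
  assumes V: "vector_field_on fibre_F V" and p: "p \<in> takano_M"
  shows "fst (D d_sigma (lift_F V) p) = 0"
proof -
  note fields = lift_F_field[OF V] field_d_sigma[of takano_M]
  have "deriv_along (lift_F V) (\<lambda>q. takano_metric q (d_sigma q) (d_sigma q)) p = 0"
    using deriv_along_inverse_fst_squared[OF p, of "lift_F V" "2 * real CARD('n)"]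
    by (simp add: d_sigma_const metric_d_sigma_right) (simp add: lift_F_def)
  moreover have "deriv_along d_sigma (\<lambda>q. takano_metric q (d_sigma q) (lift_F V q)) p = 0"
    by (simp add: takano_metric_def d_sigma_def lift_F_def deriv_along_const)
  moreover have "takano_metric p (D d_sigma d_sigma p) (lift_F V p) = 0"
    by (simp add: D_ss[OF p] takano_metric_def lift_F_def)
  ultimately have "takano_metric p (D d_sigma (lift_F V) p) (d_sigma p) = 0"
    using dualD[OF fields(1) fields(2) fields(2) p] dualD[OF fields(2) fields(2) fields(1) p]
      D_lift_sigma[OF V p] Dstar_lift_sigma[OF V p] by simp
  then show ?thesis
    using p by (simp add: d_sigma_const metric_d_sigma_right in_takano_M_iff)
qed

text \<open>
  The shape operator \<open>A\<close> determines the second fundamental form \<open>b\<close>. This is the symmetry of the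
  cubic form \<open>D G\<close> at \<open>(s, e\<^sub>i, e\<^sub>j)\<close>: duality along \<open>s\<close> for \<open>e\<^sub>i, e\<^sub>j\<close> and along \<open>e\<^sub>j\<close> for
  \<open>e\<^sub>i, s\<close> involve the same term \<open>G(e\<^sub>i, Dstar s e\<^sub>j)\<close>. The factor \<open>2 n\<close> comes from
  \<open>G(s, s) = 2 n / \<sigma>\<^sup>2\<close>, the summand \<open>2 / \<sigma>\<close> from the derivative of \<open>1 / \<sigma>\<^sup>2\<close>.
\<close>

lemma fst_D_m_m:
  assumes p: "p \<in> takano_M"
  shows "2 * real CARD('n) * fst (D (d_m j) (d_m i) p) =
    snd (D d_sigma (d_m i) p) $ j + (if i = j then 2 / fst p else 0)"
proof -
  let ?c = "if i = j then 1 else 0 :: real"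
  have pos: "fst p > 0" using p by (simp add: in_takano_M_iff)
  have "takano_metric q (d_m i q) (d_m j q) = ?c / (fst q)\<^sup>2" for q
    by (simp add: d_m_const metric_d_m_right) (simp add: axis_def)
  then have "deriv_along d_sigma (\<lambda>q. takano_metric q (d_m i q) (d_m j q)) p = - 2 * ?c / (fst p)^3"
    using deriv_along_inverse_fst_squared[OF p, of d_sigma ?c] by (simp add: d_sigma_def)
  moreover have "deriv_along (d_m j) (\<lambda>q. takano_metric q (d_m i q) (d_sigma q)) p = 0"
    by (simp add: d_m_const d_sigma_const metric_d_sigma_right deriv_along_const)
  ultimately have "takano_metric p (D (d_m j) (d_m i) p) (d_sigma p) =
      takano_metric p (D d_sigma (d_m i) p) (d_m j p) + 2 * ?c / (fst p)^3"
    using dualD[OF field_d_sigma field_d_m field_d_m p, of i j]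
      dualD[OF field_d_m field_d_m field_d_sigma p, of j i] D_m_sigma(2)[OF p, of j] by simp
  then show ?thesis
    using pos by (auto simp: d_m_const d_sigma_const metric_d_m_right metric_d_sigma_right
        field_simps power2_eq_square power3_eq_cube split: if_splits)
qed

text \<open>
  Second derivatives of vertical lifts are computed from the splitting
  \<open>D Y Z = Lift(N Y Z) + b s\<close>, with the Leibniz rule applied to \<open>b s\<close>. The same expansion yields the
  vertical part of \<open>R(e\<^sub>i, e\<^sub>j) e\<^sub>k\<close> and the horizontal part of \<open>R(s, e\<^sub>i) e\<^sub>i\<close>.
\<close>

lemma D_of_D_lift_lift:
  assumes X: "vector_field_on takano_M X"
    and Y: "vector_field_on fibre_F Y" and Z: "vector_field_on fibre_F Z" and p: "p \<in> takano_M"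
  defines "b \<equiv> \<lambda>q. fst (D (lift_F Y) (lift_F Z) q)"
  shows "D X (D (lift_F Y) (lift_F Z)) p =
    D X (lift_F (N Y Z)) p + deriv_along X b p *\<^sub>R (1, 0) + b p *\<^sub>R D X d_sigma p"
proof -
  let ?E = "D (lift_F Y) (lift_F Z)"
  have N: "vector_field_on fibre_F (N Y Z)"
    by (rule connection_field[OF N_conn Y Z])
  have E: "vector_field_on takano_M ?E"
    using Y Z by (intro connection_field[OF conn] lift_F_field)
  have b: "smooth_on takano_M b"
    unfolding b_def using E smooth_on_bounded_linear_comp[OF open_takano_M bounded_linear_fst]
    by (simp add: vector_field_on_def)
  have "smooth_on takano_M (\<lambda>q. (fst (?E q), 0 :: real ^ 'n))"
    using E smooth_on_bounded_linear_comp[OF open_takano_M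
        bounded_linear_Pair[OF bounded_linear_fst bounded_linear_zero]]
    by (simp add: vector_field_on_def)
  then have bs: "vector_field_on takano_M (\<lambda>q. b q *\<^sub>R d_sigma q)"
    by (simp add: vector_field_on_def b_def d_sigma_const)
  have eq: "?E q = lift_F (N Y Z) q + b q *\<^sub>R d_sigma q" if "q \<in> takano_M" for q
    using projD[OF Y Z that] by (simp add: prod_eq_iff lift_F_def d_sigma_def b_def)
  \<comment> \<open>smooth because it agrees on the open set with a field already known to be smooth\<close>
  have sum: "vector_field_on takano_M (\<lambda>q. lift_F (N Y Z) q + b q *\<^sub>R d_sigma q)"
    using smooth_on_cong_open[OF open_takano_M eq] E by (simp add: vector_field_on_def)
  have "D X ?E p = D X (\<lambda>q. lift_F (N Y Z) q + b q *\<^sub>R d_sigma q) p"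
    by (rule connection_cong_right[OF conn X E sum eq p])
  also have "\<dots> = D X (lift_F (N Y Z)) p + D X (\<lambda>q. b q *\<^sub>R d_sigma q) p"
    by (rule connection_add_right[OF conn X lift_F_field[OF N] bs p])
  also have "D X (\<lambda>q. b q *\<^sub>R d_sigma q) p = deriv_along X b p *\<^sub>R (1, 0) + b p *\<^sub>R D X d_sigma p"
    using connection_leibniz[OF conn b X field_d_sigma p] by (simp add: d_sigma_def)
  finally show ?thesis by simp
qed

text \<open>
  This is \<open>b\<^sub>j\<^sub>k A\<^sub>i = b\<^sub>i\<^sub>k A\<^sub>j\<close>, the Gauss equation of the fibres: the vertical part of
  \<open>R(e\<^sub>i, e\<^sub>j) e\<^sub>k\<close> consists of the curvature of the fibre and of these two products, and both
  curvatures vanish.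
\<close>

lemma gauss_equation:
  assumes p: "p \<in> takano_M"
  shows "fst (D (d_m j) (d_m k) p) *\<^sub>R snd (D d_sigma (d_m i) p) =
    fst (D (d_m i) (d_m k) p) *\<^sub>R snd (D d_sigma (d_m j) p)"
proof -
  let ?e = "\<lambda>i (_::real ^ 'n). axis i (1::real) :: real ^ 'n"
  have vertical: "snd (D (d_m i) (D (d_m j) (d_m k)) p) =
      N (?e i) (N (?e j) (?e k)) (snd p) +
      fst (D (d_m j) (d_m k) p) *\<^sub>R snd (D d_sigma (d_m i) p)" for i j
  proof -
    have "vector_field_on fibre_F (N (?e j) (?e k))"
      by (intro connection_field[OF N_conn] const_field)
    then have "snd (D (d_m i) (lift_F (N (?e j) (?e k))) p) = N (?e i) (N (?e j) (?e k)) (snd p)"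
      unfolding d_m_def by (intro projD const_field p)
    then show ?thesis
      using D_of_D_lift_lift[OF field_d_m const_field const_field p,
          of i "axis j 1" "axis k 1"] D_m_sigma(1)[OF p]
      by (simp flip: d_m_def)
  qed
  have "D (d_m i) (D (d_m j) (d_m k)) p = D (d_m j) (D (d_m i) (d_m k)) p"
    using flat_const_fields[OF conn flat field_d_m p] by (simp add: d_m_const)
  moreover have "N (?e i) (N (?e j) (?e k)) (snd p) = N (?e j) (N (?e i) (?e k)) (snd p)"
    using flat_const_fields[OF N_conn flat_F const_field] by (simp add: fibre_F_def)
  ultimately show ?thesis
    using vertical[of i j] vertical[of j i] by simp
qed

text \<open>
  The \<open>j\<close>-th component of the Gauss equation for \<open>R(e\<^sub>i, e\<^sub>j) e\<^sub>j\<close> reads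
  \<open>(A\<^sub>j\<^sub>j + 2/\<sigma>) A\<^sub>i\<^sub>j = A\<^sub>j\<^sub>i A\<^sub>j\<^sub>j\<close>. As \<open>b\<close> is symmetric by torsion-freeness, so is \<open>A\<close>, and only
  \<open>(2/\<sigma>) A\<^sub>i\<^sub>j = 0\<close> remains.
\<close>

lemma D_sigma_m_off_diagonal:
  assumes p: "p \<in> takano_M" and ij: "i \<noteq> j"
  shows "snd (D d_sigma (d_m i) p) $ j = 0"
proof -
  define A where "A i j = snd (D d_sigma (d_m i) p) $ j" for i j
  have pos: "fst p > 0" using p by (simp add: in_takano_M_iff)
  have b: "2 * real CARD('n) * fst (D (d_m j) (d_m i) p) = A i j + (if i = j then 2 / fst p else 0)"
    for i j using fst_D_m_m[OF p] by (simp add: A_def)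
  have sym: "A i j = A j i"
    using b[of i j] b[of j i] D_m_m_commute[OF p, of i j] ij by simp
  have "fst (D (d_m j) (d_m j) p) * A i j = fst (D (d_m i) (d_m j) p) * A j j"
    using arg_cong[OF gauss_equation[OF p, of j j i], of "\<lambda>v. v $ j"] by (simp add: A_def)
  then have "(2 * real CARD('n) * fst (D (d_m j) (d_m j) p)) * A i j =
      (2 * real CARD('n) * fst (D (d_m i) (d_m j) p)) * A j j"
    by simp
  then have "2 / fst p * A i j = 0"
    unfolding b using sym ij by (simp add: algebra_simps)
  then show ?thesis
    using pos by (simp add: A_def)
qed

text \<open>
  With \<open>A\<close> diagonal, the Gauss equation becomes \<open>(A\<^sub>l\<^sub>l + 2/\<sigma>) A\<^sub>k\<^sub>k = 0\<close> for \<open>k \<noteq> l\<close>. If one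
  eigenvalue is nonzero, then the other one is \<open>-2/\<sigma>\<close>, hence nonzero, and so the first one is
  \<open>-2/\<sigma>\<close> as well. This step needs two distinct fibre directions.
\<close>

lemma D_sigma_m_eigenvalue:
  assumes p: "p \<in> takano_M" and "i \<noteq> j"
  defines "x \<equiv> snd (D d_sigma (d_m i) p) $ i"
  shows "x = 0 \<or> x = - 2 / fst p"
proof -
  define A where "A i = snd (D d_sigma (d_m i) p) $ i" for i
  have pos: "fst p > 0" using p by (simp add: in_takano_M_iff)
  have prod: "(A l + 2 / fst p) * A k = 0" if "k \<noteq> l" for k l
  proof -
    have "fst (D (d_m l) (d_m l) p) * A k = fst (D (d_m k) (d_m l) p) * snd (D d_sigma (d_m l) p) $ k"
      using arg_cong[OF gauss_equation[OF p, of l l k], of "\<lambda>v. v $ k"] by (simp add: A_def)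
    then have "fst (D (d_m l) (d_m l) p) * A k = 0"
      using D_sigma_m_off_diagonal[OF p] that by simp
    then show ?thesis
      using fst_D_m_m[OF p, of l l] by (auto simp: A_def)
  qed
  have "A i = 0 \<or> A i = - 2 / fst p"
  proof (cases "A i = 0")
    case False
    then have "A j \<noteq> 0" using prod[of i j] assms(2) pos by auto
    then show ?thesis using prod[of j i] assms(2) by (simp add: add_eq_0_iff)
  qed simp
  then show ?thesis by (simp add: x_def A_def)
qed

text \<open>
  From here on \<open>x\<close> is the eigenvalue \<open>A\<^sub>i\<^sub>i\<close> as a function on the whole of \<open>M\<close>, so that
  \<open>D s e\<^sub>i = x e\<^sub>i\<close> can be differentiated.
\<close>

context
  fixes i :: 'n and x :: "real \<times> (real ^ 'n) \<Rightarrow> real"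
  defines "x \<equiv> \<lambda>q. snd (D d_sigma (d_m i) q) $ i"
begin

lemma D_sigma_m:
  assumes "p \<in> takano_M"
  shows "D d_sigma (d_m i) p = x p *\<^sub>R d_m i p"
proof -
  have "snd (D d_sigma (d_m i) p) = x p *\<^sub>R axis i 1"
    using D_sigma_m_off_diagonal[OF assms, of i] by (auto simp: vec_eq_iff x_def axis_def)
  moreover have "fst (D d_sigma (d_m i) p) = 0"
    unfolding d_m_def by (rule fst_D_sigma_lift[OF const_field assms])
  ultimately show ?thesis
    by (simp add: prod_eq_iff d_m_const)
qed

lemma smooth_eigenvalue: "smooth_on takano_M x"
proof -
  have "smooth_on takano_M (D d_sigma (d_m i))"
    using connection_field[OF conn field_d_sigma field_d_m] by (simp add: vector_field_on_def)
  then show ?thesis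
    unfolding x_def by (rule smooth_on_bounded_linear_comp[OF open_takano_M
        bounded_linear_compose[OF bounded_linear_vec_nth bounded_linear_snd]])
qed

text \<open>
  The field \<open>Y\<close> stands for \<open>D s e\<^sub>i\<close> or for \<open>D e\<^sub>i s\<close>, which agree on \<open>M\<close> but may differ outside it.
\<close>

lemma D_along_D_sigma_m:
  assumes X: "vector_field_on takano_M X" and p: "p \<in> takano_M"
    and Y: "vector_field_on takano_M Y" "\<And>q. q \<in> takano_M \<Longrightarrow> Y q = D d_sigma (d_m i) q"
  shows "D X Y p = deriv_along X x p *\<^sub>R d_m i p + x p *\<^sub>R D X (d_m i) p"
proof -
  have "vector_field_on takano_M (\<lambda>q. x q *\<^sub>R d_m i q)"
    using smooth_on_cong_open[OF open_takano_M, of Y] D_sigma_m Y by (simp add: vector_field_on_def)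
  then have "D X Y p = D X (\<lambda>q. x q *\<^sub>R d_m i q) p"
    using connection_cong_right[OF conn X Y(1)] D_sigma_m Y(2) p by simp
  then show ?thesis
    using connection_leibniz[OF conn smooth_eigenvalue X field_d_m p] by simp
qed

text \<open>
  This is the \<open>e\<^sub>i\<close>-component of \<open>R(s, e\<^sub>i) s = 0\<close>, that is, of
  \<open>D s (x e\<^sub>i) = D e\<^sub>i (a s)\<close>.
\<close>

lemma riccati_equation:
  assumes p: "p \<in> takano_M"
  shows "deriv_along d_sigma x p + (x p)\<^sup>2 = a (fst p) * x p"
proof -
  let ?s = "d_sigma :: real \<times> (real ^ 'n) \<Rightarrow> _"
  let ?f = "\<lambda>q. fst (D ?s ?s q)"
  have ss: "vector_field_on takano_M (D ?s ?s)"
    by (intro connection_field[OF conn] field_d_sigma)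
  then have f: "smooth_on takano_M ?f"
    using smooth_on_bounded_linear_comp[OF open_takano_M bounded_linear_fst]
    by (simp add: vector_field_on_def)
  have eq: "D ?s ?s q = ?f q *\<^sub>R ?s q" if "q \<in> takano_M" for q
    using D_ss[OF that] by (simp add: d_sigma_def)
  have "vector_field_on takano_M (\<lambda>q. ?f q *\<^sub>R ?s q)"
    using smooth_on_cong_open[OF open_takano_M eq] ss by (simp add: vector_field_on_def)
  then have "D (d_m i) (D ?s ?s) p = D (d_m i) (\<lambda>q. ?f q *\<^sub>R ?s q) p"
    using connection_cong_right[OF conn field_d_m ss _ eq p] by simp
  also have "\<dots> = deriv_along (d_m i) ?f p *\<^sub>R ?s p + ?f p *\<^sub>R D (d_m i) ?s p"
    by (rule connection_leibniz[OF conn f field_d_m field_d_sigma p])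
  finally have L: "snd (D (d_m i) (D ?s ?s) p) = (a (fst p) * x p) *\<^sub>R axis i 1"
    using D_sigma_m[OF p] D_m_sigma(1)[OF p] D_ss[OF p] by (simp add: d_sigma_def d_m_const)
  have "D ?s (D (d_m i) ?s) p = D (d_m i) (D ?s ?s) p"
    using flat_const_fields[OF conn flat field_d_sigma p] by (simp add: d_m_const d_sigma_const)
  moreover have "D ?s (D (d_m i) ?s) p =
      deriv_along ?s x p *\<^sub>R d_m i p + x p *\<^sub>R D ?s (d_m i) p"
    by (intro D_along_D_sigma_m field_d_sigma connection_field[OF conn] field_d_m p D_m_sigma(1))
  ultimately have "(deriv_along ?s x p *\<^sub>R axis i 1 + (x p)\<^sup>2 *\<^sub>R axis i 1) $ i =
      ((a (fst p) * x p) *\<^sub>R axis i 1 :: real ^ 'n) $ i"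
    using L D_sigma_m[OF p] by (simp add: d_m_const power2_eq_square)
  then show ?thesis by simp
qed

text \<open>
  The \<open>s\<close>-component of \<open>R(s, e\<^sub>i) e\<^sub>i = 0\<close> is \<open>b' + a b = x b\<close> for \<open>b = b\<^sub>i\<^sub>i\<close>. Substituting
  \<open>2 n b = x + 2/\<sigma>\<close> gives a second first-order equation for \<open>x\<close> and \<open>a\<close>.
\<close>

lemma horizontal_curvature_equation:
  assumes p: "p \<in> takano_M"
  shows "deriv_along d_sigma x p - 2 / (fst p)\<^sup>2 + (a (fst p) - x p) * (x p + 2 / fst p) = 0"
proof -
  let ?s = "d_sigma :: real \<times> (real ^ 'n) \<Rightarrow> _"
  let ?n = "real CARD('n)"
  define b where "b = (\<lambda>q. fst (D (d_m i) (d_m i) q))"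
  have N: "vector_field_on fibre_F (N (\<lambda>_. axis i 1) (\<lambda>_. axis i 1))"
    by (intro connection_field[OF N_conn] const_field)
  have "D ?s (D (d_m i) (d_m i)) p = D (d_m i) (D ?s (d_m i)) p"
    using flat_const_fields[OF conn flat field_d_m p] by (simp add: d_m_const d_sigma_const)
  moreover have "D (d_m i) (D ?s (d_m i)) p =
      deriv_along (d_m i) x p *\<^sub>R d_m i p + x p *\<^sub>R D (d_m i) (d_m i) p"
    by (intro D_along_D_sigma_m field_d_sigma connection_field[OF conn] field_d_m p refl)
  moreover have "fst (D ?s (D (d_m i) (d_m i)) p) = deriv_along ?s b p + b p * a (fst p)"
    using D_of_D_lift_lift[OF field_d_sigma const_field const_field p,
        of "axis i 1" "axis i 1"] fst_D_sigma_lift[OF N p] D_ss[OF p]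
    by (simp add: b_def flip: d_m_def)
  ultimately have "deriv_along ?s b p + b p * a (fst p) = x p * b p"
    by (simp add: b_def d_m_const)
  then have b': "deriv_along ?s b p = (x p - a (fst p)) * b p"
    by (simp add: algebra_simps)
  have eq: "2 * ?n * deriv_along ?s b p + (a (fst p) - x p) * (2 * ?n * b p) = 0"
    unfolding b' by (simp add: algebra_simps)
  have b: "2 * ?n * b q = x q + 2 / fst q" if "q \<in> takano_M" for q
    using fst_D_m_m[OF that, of i i] by (simp add: b_def x_def)
  have pos: "fst p > 0" using p by (simp add: in_takano_M_iff)
  have "2 * ?n * deriv_along ?s b p = deriv_along ?s x p - 2 / (fst p)\<^sup>2"
  proof -
    have "(x has_derivative frechet_derivative x (at p)) (at p)"
      using smooth_on_imp_differentiable[OF smooth_eigenvalue p] frechet_derivative_works by blast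
    then have "((\<lambda>q. (x q + 2 / fst q) / (2 * ?n)) has_derivative
        (\<lambda>v. (frechet_derivative x (at p) v - 2 * fst v / (fst p)\<^sup>2) / (2 * ?n))) (at p)"
      using pos by (auto intro!: derivative_eq_intros simp: fun_eq_iff field_simps power2_eq_square)
    then have "(b has_derivative
        (\<lambda>v. (frechet_derivative x (at p) v - 2 * fst v / (fst p)\<^sup>2) / (2 * ?n))) (at p)"
      by (rule has_derivative_transform_within_open[OF _ open_takano_M p])
        (simp flip: b)
    then show ?thesis
      by (simp add: deriv_along_def frechet_derivative_at[symmetric] d_sigma_def)
  qed
  then show ?thesis
    using eq b[OF p] by simp
qed

end

text \<open>
  The two differential equations hold at every point, with the derivative \<open>x'\<close> as an unknown of its
  own; so the value of \<open>x\<close> at one point already decides \<open>a\<close> there. If \<open>x = 0\<close>, the Riccati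
  equation gives \<open>x' = 0\<close> and the other one \<open>a = 1/\<sigma>\<close>; if \<open>x = -2/\<sigma>\<close>, the second equation gives
  \<open>x' = 2/\<sigma>\<^sup>2\<close> and the Riccati equation \<open>a = -3/\<sigma>\<close>.
\<close>

lemma base_coefficient_values:
  assumes "CARD('n) \<ge> 2" and r: "r > 0"
  shows "r * a r = 1 \<or> r * a r = - 3"
proof -
  have "\<exists>i j :: 'n. i \<noteq> j"
    using assms(1) card_le_Suc0_iff_eq[of "UNIV :: 'n set"] by auto
  then obtain i j :: 'n where ij: "i \<noteq> j" by blast
  define p :: "real \<times> (real ^ 'n)" where "p = (r, 0)"
  have p: "p \<in> takano_M" "fst p = r" using r by (simp_all add: p_def in_takano_M_iff)
  define x where "x = (\<lambda>q. snd (D d_sigma (d_m i) q) $ i)"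
  define x' where "x' = deriv_along d_sigma x p"
  have 1: "x' + (x p)\<^sup>2 = a r * x p"
    using riccati_equation[OF p(1), of i] p(2) by (simp add: x'_def x_def)
  have 2: "x' - 2 / r\<^sup>2 + (a r - x p) * (x p + 2 / r) = 0"
    using horizontal_curvature_equation[OF p(1), of i] p(2) by (simp add: x'_def x_def)
  have "x p = 0 \<or> x p = - 2 / r"
    using D_sigma_m_eigenvalue[OF p(1) ij] p(2) by (simp add: x_def)
  then show ?thesis
  proof
    assume "x p = 0"
    then show ?thesis
      using 1 2 r by (simp add: field_simps power2_eq_square)
  next
    assume x: "x p = - 2 / r"
    then have "x' = 2 / r\<^sup>2" using 2 r by simp
    then show ?thesis
      using 1 x r by (simp add: field_simps power2_eq_square)
  qed
qed

end

theorem theorem5p1: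
  fixes D Dstar :: "(real \<times> (real ^ 'n) \<Rightarrow> real \<times> (real ^ 'n)) \<Rightarrow> (real \<times> (real ^ 'n) \<Rightarrow> real \<times> (real ^ 'n)) \<Rightarrow>
                    real \<times> (real ^ 'n) \<Rightarrow> real \<times> (real ^ 'n)"
    and nablaF :: "(real ^ 'n \<Rightarrow> real ^ 'n) \<Rightarrow> (real ^ 'n \<Rightarrow> real ^ 'n) \<Rightarrow> real ^ 'n \<Rightarrow> real ^ 'n"
  assumes "CARD('n) \<ge> 2"
    and "affine_connection takano_M D"
    and "is_dual_connection takano_M takano_metric D Dstar"
    and "torsion_free takano_M D"
    and "torsion_free takano_M Dstar"
    and "is_projected_connection D nablaF"
    and "\<forall>X\<in>lifts_B. \<forall>Y\<in>lifts_B. D X Y \<in> lifts_B"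
    and "\<forall>V W. vector_field_on fibre_F V \<longrightarrow> vector_field_on fibre_F W \<longrightarrow>
           (\<forall>p\<in>takano_M. Ver (D (lift_F V) (lift_F W)) p = lift_F (nablaF V W) p)"
    and "curvature_vanishes takano_M D"
    and "curvature_vanishes fibre_F nablaF"
  shows "(\<forall>p\<in>takano_M. D d_sigma d_sigma p = (1 / fst p) *\<^sub>R d_sigma p) \<or>
         (\<forall>p\<in>takano_M. D d_sigma d_sigma p = (- 3 / fst p) *\<^sub>R d_sigma p)"
proof -
  let ?s = "d_sigma :: real \<times> (real ^ 'n) \<Rightarrow> real \<times> (real ^ 'n)"
  have "?s \<in> lifts_B"
    by (auto simp: lifts_B_def lift_B_def d_sigma_def intro!: exI[of _ "\<lambda>_. 1"] const_field)
  then obtain a where a: "vector_field_on base_B a"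
      and D_ss: "\<And>p. p \<in> takano_M \<Longrightarrow> D ?s ?s p = (a (fst p), 0)"
    using assms(7) unfolding lifts_B_def lift_B_def by blast
  interpret flat_takano_connection D Dstar nablaF a
    by unfold_locales (fact assms D_ss)+
  \<comment> \<open>a continuous function on the half-line with at most two values is constant\<close>
  have "connected ((\<lambda>r. r * a r) ` {0<..})"
    using a smooth_on_imp_continuous_on
    by (intro connected_continuous_image continuous_intros)
      (auto simp: vector_field_on_def base_B_def)
  moreover have two_values: "(\<lambda>r. r * a r) ` {0<..} \<subseteq> {1, - 3}"
    using base_coefficient_values[OF assms(1)] by blast
  then have "finite ((\<lambda>r. r * a r) ` {0<..})"
    using finite_subset by blast
  ultimately have "(\<lambda>r. r * a r) ` {0<..} = {} \<or> (\<exists>c. (\<lambda>r. r * a r) ` {0<..} = {c})"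
    using connected_finite_iff_sing by blast
  then obtain c where c: "(\<lambda>r. r * a r) ` {0<..} = {c}" by auto
  then have "c = 1 \<or> c = - 3"
    using two_values by simp
  moreover have "a (fst p) = c / fst p" if "p \<in> (takano_M :: (real \<times> (real ^ 'n)) set)" for p
  proof -
    have pos: "fst p > 0" using that by (simp add: in_takano_M_iff)
    then have "fst p * a (fst p) \<in> (\<lambda>r. r * a r) ` {0<..}" by simp
    then have "fst p * a (fst p) = c" unfolding c by simp
    then show ?thesis using pos by (simp add: field_simps)
  qed
  ultimately show ?thesis
    using D_ss by (auto simp: d_sigma_def)
qed

end
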